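(* If $G$ is a nice triangle-free graph, then $\mathrm{ch}_\Pi^*(G) \leq \Delta(G)+3$.
   Context: Graphs are finite and simple. A graph is nice if it has no connected component isomorphic to $K_2$. $\Delta(G)$ is the maximum degree of $G$. A $k$-list assignment $L$ of $G$ assigns to every edge $e \in E(G)$ a set $L(e)$ of $k$ real numbers. An $L$-labelling is a map $\ell$ on $E(G)$ with $\ell(e) \in L(e)$ for every edge $e$. For a vertex $v$, set $\pi_\ell(v)=\prod_{w \in N(v)} \ell(vw)$. The labelling $\ell$ is p-proper if $\pi_\ell(u) \neq \pi_\ell(v)$ for every edge $uv$. $\mathrm{ch}_\Pi^*(G)$ is the smallest $k \geq 1$, if any, such that $G$ admits a p-proper $L$-labelling for every $k$-list assignment $L$ with $0 \notin L(e)$ for every edge $e$. *)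

theory Defs
  imports
    Complex_Main
    "HOL-Library.Extended_Nat"
    "Graph_Theory.Digraph_Component"
    "Graph_Theory.Kuratowski"
begin

text \<open>
  A finite simple graph is an instance of the locale \<^locale>\<open>graph\<close>: a finite symmetric digraph
  without loops and parallel arcs. An undirected edge is the set of its two end vertices, so the
  two arcs \<open>u \<rightarrow> v\<close> and \<open>v \<rightarrow> u\<close> form a single edge, which carries a single list and a single label.
\<close>

definition edges :: "('a, 'b) pre_digraph \<Rightarrow> 'a set set" where
  "edges G = {{u, v} | u v. u \<rightarrow>\<^bsub>G\<^esub> v}"

definition neighbours :: "('a, 'b) pre_digraph \<Rightarrow> 'a \<Rightarrow> 'a set" where
  "neighbours G v = {w. v \<rightarrow>\<^bsub>G\<^esub> w}"

text \<open>Inserting \<open>0\<close> only matters for the graph without vertices, whose maximum degree is then \<open>0\<close>.\<close>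

definition max_degree :: "('a, 'b) pre_digraph \<Rightarrow> nat" where
  "max_degree G = Max (insert 0 ((\<lambda>v. card (neighbours G v)) ` verts G))"

text \<open>
  The strongly connected components of a symmetric digraph are the connected components of the
  undirected graph that it represents, and \<^term>\<open>complete_digraph 2 C\<close> says that \<open>C\<close> is a
  complete graph on two vertices.
\<close>

definition nice :: "('a, 'b) pre_digraph \<Rightarrow> bool" where
  "nice G \<longleftrightarrow> \<not> (\<exists>C \<in> pre_digraph.sccs G. complete_digraph 2 C)"

definition triangle_free :: "('a, 'b) pre_digraph \<Rightarrow> bool" where
  "triangle_free G \<longleftrightarrow> \<not> (\<exists>u v w. u \<rightarrow>\<^bsub>G\<^esub> v \<and> v \<rightarrow>\<^bsub>G\<^esub> w \<and> w \<rightarrow>\<^bsub>G\<^esub> u)"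

definition list_assignment ::
    "('a, 'b) pre_digraph \<Rightarrow> nat \<Rightarrow> ('a set \<Rightarrow> real set) \<Rightarrow> bool" where
  "list_assignment G k L \<longleftrightarrow> (\<forall>e \<in> edges G. finite (L e) \<and> card (L e) = k)"

definition labelling ::
    "('a, 'b) pre_digraph \<Rightarrow> ('a set \<Rightarrow> real set) \<Rightarrow> ('a set \<Rightarrow> real) \<Rightarrow> bool" where
  "labelling G L l \<longleftrightarrow> (\<forall>e \<in> edges G. l e \<in> L e)"

definition vertex_product :: "('a, 'b) pre_digraph \<Rightarrow> ('a set \<Rightarrow> real) \<Rightarrow> 'a \<Rightarrow> real" where
  "vertex_product G l v = (\<Prod>w \<in> neighbours G v. l {v, w})"

definition p_proper :: "('a, 'b) pre_digraph \<Rightarrow> ('a set \<Rightarrow> real) \<Rightarrow> bool" where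
  "p_proper G l \<longleftrightarrow> (\<forall>u v. u \<rightarrow>\<^bsub>G\<^esub> v \<longrightarrow> vertex_product G l u \<noteq> vertex_product G l v)"

text \<open>The infimum is a minimum if some \<open>k\<close> qualifies, and it is \<open>\<infinity>\<close> if none does.\<close>

definition ch_prod_star :: "('a, 'b) pre_digraph \<Rightarrow> enat" where
  "ch_prod_star G = Inf (enat ` {k. k \<ge> 1 \<and>
     (\<forall>L. list_assignment G k L \<and> (\<forall>e \<in> edges G. 0 \<notin> L e) \<longrightarrow>
        (\<exists>l. labelling G L l \<and> p_proper G l))})"

end

theory Submission
  imports Defs
begin

text \<open>
  Delete a vertex \<open>v\<close> of degree at least two and label the rest by induction, putting no condition on
  isolated edges. As the neighbours of \<open>v\<close> are pairwise non-adjacent, relabelling \<open>vu\<close> affects, besides the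
  edges at \<open>v\<close>, only the at most \<open>\<Delta> - 1\<close> other edges at \<open>u\<close>, each of which forbids one label of \<open>vu\<close>,
  also if it had become isolated. So at least three labels remain for each
  edge at \<open>v\<close>, two of which differ in absolute value. After cancelling the label of \<open>vu\<close>, the
  condition at \<open>vu\<close> says that the product of the other labels at \<open>v\<close> avoids a constant.
\<close>

section \<open>Choosing numbers whose partial products avoid prescribed values\<close>

text \<open>This gives each condition \<open>i\<close> a coordinate \<open>f i\<close> of its own
  that occurs in the product over \<open>N - {i}\<close>. A cyclic shift along an enumeration of
  \<open>N\<close> does it.\<close>

lemma exists_fixpoint_free_bij:
  assumes "finite N" and "2 \<le> card N"
  obtains f where "bij_betw f N N" and "\<And>i. i \<in> N \<Longrightarrow> f i \<noteq> i"
proof -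
  let ?n = "card N"
  obtain h where h: "bij_betw h {0..<?n} N"
    using ex_bij_betw_nat_finite[OF assms(1)] by blast
  \<comment> \<open>The cyclic successor on the indices; it moves every index because
    \<open>?n\<close> is at least 2.\<close>
  define s where "s k = (if Suc k = ?n then 0 else Suc k)" for k
  have "inj_on s {0..<?n}" by (auto simp: inj_on_def s_def split: if_splits)
  moreover have "s ` {0..<?n} \<subseteq> {0..<?n}" by (auto simp: s_def)
  ultimately have "bij_betw s {0..<?n} {0..<?n}"
    by (simp add: bij_betw_def endo_inj_surj)
  with h have f: "bij_betw (h \<circ> s \<circ> inv_into {0..<?n} h) N N"
    by (meson bij_betw_inv_into bij_betw_trans)
  have "(h \<circ> s \<circ> inv_into {0..<?n} h) i \<noteq> i" if "i \<in> N" for i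
  proof -
    have "i \<in> h ` {0..<?n}" using h that by (simp add: bij_betw_def)
    then obtain k where k: "k < ?n" "i = h k" by auto
    have "inv_into {0..<?n} h i = k"
      using h k by (simp add: bij_betw_def inv_into_f_f)
    moreover have "s k < ?n" "s k \<noteq> k" using k assms(2) by (auto simp: s_def)
    ultimately show ?thesis using h k by (auto simp: bij_betw_def inj_on_eq_iff)
  qed
  with f show ?thesis using that by blast
qed

text \<open>Only \<open>a\<close> and \<open>-a\<close> share the absolute value of
  \<open>a\<close>, so a third element must differ from it in absolute value.\<close>

lemma exists_abs_less:
  fixes S :: "'a :: linordered_idom set"
  assumes "3 \<le> card S"
  obtains a b where "a \<in> S" and "b \<in> S" and "\<bar>a\<bar> < \<bar>b\<bar>"
proof -
  obtain a where a: "a \<in> S" using assms by fastforce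
  have "\<not> S \<subseteq> {a, -a}"
  proof
    assume "S \<subseteq> {a, -a}"
    then have "card S \<le> card {a, -a}" by (intro card_mono) auto
    also have "\<dots> \<le> 2" by (simp add: card_insert_if)
    finally show False using assms by simp
  qed
  then obtain b where "b \<in> S" "b \<noteq> a" "b \<noteq> -a" by auto
  then have "\<bar>a\<bar> \<noteq> \<bar>b\<bar>" by (auto simp: abs_eq_iff)
  with a \<open>b \<in> S\<close> that show ?thesis by (meson linorder_neqE)
qed

text \<open>
  Start with the smaller absolute value everywhere. Whenever condition \<open>i\<close> fails, switch the
  coordinate \<open>f i \<noteq> i\<close> to the larger one: absolute values only grow, so condition \<open>i\<close> never fails
  again, and no coordinate is switched twice. In the proof, \<open>A\<close> is the set of switched coordinates.
\<close>

lemma exists_choice_prod_remove_neq: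
  fixes S :: "'i \<Rightarrow> 'a :: linordered_field set"
  assumes "finite N" and "2 \<le> card N"
    and S: "\<And>i. i \<in> N \<Longrightarrow> 3 \<le> card (S i)" "\<And>i. i \<in> N \<Longrightarrow> 0 \<notin> S i"
  obtains x where "\<And>i. i \<in> N \<Longrightarrow> x i \<in> S i"
    and "\<And>i. i \<in> N \<Longrightarrow> prod x (N - {i}) \<noteq> c i"
proof -
  have "\<forall>i\<in>N. \<exists>a b. a \<in> S i \<and> b \<in> S i \<and> \<bar>a\<bar> < \<bar>b\<bar>"
    using S(1) exists_abs_less by metis
  then obtain a b where ab: "\<And>i. i \<in> N \<Longrightarrow> a i \<in> S i \<and> b i \<in> S i \<and> \<bar>a i\<bar> < \<bar>b i\<bar>"
    by metis
  obtain f where f: "bij_betw f N N" "\<And>i. i \<in> N \<Longrightarrow> f i \<noteq> i"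
    using exists_fixpoint_free_bij assms(1,2) by blast
  define x where "x A i = (if i \<in> A then b i else a i)" for A i
  define p where "p A i = \<bar>prod (x A) (N - {i})\<bar>" for A i
  \<comment> \<open>Invariant of the switching: once the coordinate assigned to condition
    \<open>i\<close> is switched, the product exceeds \<open>c i\<close> strictly in absolute value,
    so condition \<open>i\<close> holds for good.\<close>
  define good where "good A \<longleftrightarrow> A \<subseteq> N \<and> (\<forall>i\<in>N. f i \<in> A \<longrightarrow> \<bar>c i\<bar> < p A i)" for A
  have nz: "x A i \<noteq> 0" if "i \<in> N" for A i
    using ab[OF that] S(2)[OF that] by (auto simp: x_def)
  have mono: "p A i \<le> p (insert k A) i" if "k \<in> N" for A i k
    unfolding p_def abs_prod using that ab
    by (intro prod_mono) (auto simp: x_def less_imp_le)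
  \<comment> \<open>Growth is strict because \<open>k\<close> occurs in the product and the other
    factors are nonzero.\<close>
  have strict: "p A i < p (insert k A) i" if "k \<in> N" "k \<notin> A" "k \<noteq> i" for A i k
  proof -
    let ?R = "N - {i} - {k}"
    have split: "p B i = \<bar>x B k\<bar> * \<bar>prod (x B) ?R\<bar>" for B
      using that assms(1) by (simp add: p_def prod.remove[of "N - {i}" k] abs_mult)
    have "prod (x (insert k A)) ?R = prod (x A) ?R"
      by (intro prod.cong) (auto simp: x_def)
    moreover have "prod (x A) ?R \<noteq> 0"
      using nz assms(1) by simp
    moreover have "\<bar>x A k\<bar> < \<bar>x (insert k A) k\<bar>"
      using that ab by (simp add: x_def)
    ultimately show ?thesis by (simp add: split)
  qed
  have "finite {A. good A}"
    using assms(1) by (auto intro: finite_subset[of _ "Pow N"] simp: good_def)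
  moreover have "good {}" by (simp add: good_def)
  \<comment> \<open>A maximal good set is a final state of the switching: a failing condition would
    permit one more switch.\<close>
  ultimately obtain A where A: "good A" "\<And>B. good B \<Longrightarrow> A \<subseteq> B \<Longrightarrow> A = B"
    using finite_has_maximal[of "{A. good A}"] by blast
  have "prod (x A) (N - {i}) \<noteq> c i" if i: "i \<in> N" for i
  proof
    assume eq: "prod (x A) (N - {i}) = c i"
    have fi: "f i \<in> N" using f(1) i by (auto simp: bij_betw_def)
    have notin: "f i \<notin> A" using A(1) i eq by (auto simp: good_def p_def)
    have "\<bar>c j\<bar> < p (insert (f i) A) j" if j: "j \<in> N" "f j \<in> insert (f i) A" for j
    proof (cases "f j \<in> A")
      case True
      then have "\<bar>c j\<bar> < p A j" using A(1) j by (auto simp: good_def)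
      then show ?thesis using mono[OF fi] by (rule less_le_trans)
    next
      case False
      \<comment> \<open>By injectivity of \<open>f\<close>, the switch puts only condition
        \<open>i\<close> newly under the invariant; there the equality
        \<open>p A i = \<bar>c i\<bar>\<close> turns into strict excess.\<close>
      then have "j = i" using f(1) i j by (auto simp: bij_betw_def inj_on_eq_iff)
      then show ?thesis using strict[OF fi notin] f(2)[OF i] eq by (metis p_def)
    qed
    then have "good (insert (f i) A)" using A(1) fi by (auto simp: good_def)
    with A(2) notin show False by blast
  qed
  moreover have "x A i \<in> S i" if "i \<in> N" for i using ab[OF that] by (simp add: x_def)
  ultimately show ?thesis using that by blast
qed

section \<open>Induction by deleting a vertex\<close>

text \<open>Isolated edges are exempt since both ends have the edge label as product, and deleting a
  vertex can create such edges. With the graph given by a relation \<open>E\<close>, deletion just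
  restricts \<open>E\<close>, while \<open>L\<close> and the degree bound \<open>D\<close> stay
  fixed.\<close>

lemma exists_labelling_neq_except_isolated:
  fixes E :: "'a \<Rightarrow> 'a \<Rightarrow> bool" and L :: "'a set \<Rightarrow> 'b :: linordered_field set"
  assumes "finite V"
    and "\<And>u v. E u v \<Longrightarrow> u \<in> V"
    and "\<And>u v. E u v \<Longrightarrow> E v u"
    and "\<And>u. \<not> E u u"
    and "\<And>u v w. E u v \<Longrightarrow> E v w \<Longrightarrow> \<not> E w u"
    and "\<And>v. card {w. E v w} \<le> D"
    and "\<And>u v. E u v \<Longrightarrow> D + 2 \<le> card (L {u, v})"
    and "\<And>u v. E u v \<Longrightarrow> 0 \<notin> L {u, v}"
  shows "\<exists>l. (\<forall>u v. E u v \<longrightarrow> l {u, v} \<in> L {u, v}) \<and>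
    (\<forall>u v. E u v \<longrightarrow> {w. E u w} \<noteq> {v} \<or> {w. E v w} \<noteq> {u} \<longrightarrow>
      (\<Prod>w | E u w. l {u, w}) \<noteq> (\<Prod>w | E v w. l {v, w}))"
  using assms
proof (induction V arbitrary: E rule: finite_psubset_induct)
  case (psubset V)
  note inV = psubset.prems(1) and sym = psubset.prems(2) and irrefl = psubset.prems(3)
    and tri = psubset.prems(4) and deg = psubset.prems(5)
    and cardL = psubset.prems(6) and L0 = psubset.prems(7)
  have fin: "finite {w. E u w}" for u
    using psubset.hyps inV sym by (metis finite_subset mem_Collect_eq subsetI)
  show ?case
  proof (cases "\<exists>v. 2 \<le> card {w. E v w}")
    case False
    \<comment> \<open>All degrees are at most one, so every edge is isolated and any choice from the
      nonempty lists will do.\<close>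
    have single: "{w. E u w} = {v}" if "E u v" for u v
    proof -
      have "card {w. E u w} \<le> card {v}" using False
        by (simp add: not_le less_Suc_eq_le numeral_2_eq_2)
      then show ?thesis using that fin
        by (metis card_seteq empty_subsetI insert_subset mem_Collect_eq)
    qed
    have "\<exists>y. y \<in> L {u, v}" if "E u v" for u v
      using cardL[OF that] by (metis add_2_eq_Suc' card.empty equals0I not_less_eq_eq zero_le)
    then have "\<forall>u v. E u v \<longrightarrow> (SOME y. y \<in> L {u, v}) \<in> L {u, v}"
      by (meson someI_ex)
    with single sym show ?thesis
      by (intro exI[of _ "\<lambda>e. SOME y. y \<in> L e"]) blast
  next
    case True
    then obtain v where v: "2 \<le> card {w. E v w}" by blast
    define N where "N = {w. E v w}"
    define E' where "E' x y \<longleftrightarrow> E x y \<and> x \<noteq> v \<and> y \<noteq> v" for x y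
    have "v \<in> V" using v inV by (metis card.empty empty_Collect_eq not_numeral_le_zero)
    then have subset: "V - {v} \<subset> V" by blast
    have deg': "card {w. E' x w} \<le> D" for x
    proof -
      have "card {w. E' x w} \<le> card {w. E x w}"
        using fin by (intro card_mono) (auto simp: E'_def)
      with deg[of x] show ?thesis by linarith
    qed
    have "\<exists>l. (\<forall>x y. E' x y \<longrightarrow> l {x, y} \<in> L {x, y}) \<and>
      (\<forall>x y. E' x y \<longrightarrow> {w. E' x w} \<noteq> {y} \<or> {w. E' y w} \<noteq> {x} \<longrightarrow>
        (\<Prod>w | E' x w. l {x, w}) \<noteq> (\<Prod>w | E' y w. l {y, w}))"
    proof (rule psubset.IH[OF subset _ _ _ _ deg'])
      show "x \<in> V - {v}" if "E' x y" for x y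
        using that inV unfolding E'_def by blast
      show "E' y x" if "E' x y" for x y
        using that sym unfolding E'_def by blast
      show "\<not> E' x x" for x
        using irrefl unfolding E'_def by blast
      show "\<not> E' z x" if "E' x y" "E' y z" for x y z
        using that tri unfolding E'_def by blast
      show "D + 2 \<le> card (L {x, y})" if "E' x y" for x y
        using that cardL unfolding E'_def by blast
      show "0 \<notin> L {x, y}" if "E' x y" for x y
        using that L0 unfolding E'_def by blast
    qed
    then obtain l' where l'L: "\<forall>x y. E' x y \<longrightarrow> l' {x, y} \<in> L {x, y}"
      and l'neq: "\<forall>x y. E' x y \<longrightarrow> {w. E' x w} \<noteq> {y} \<or> {w. E' y w} \<noteq> {x} \<longrightarrow>
        (\<Prod>w | E' x w. l' {x, w}) \<noteq> (\<Prod>w | E' y w. l' {y, w})"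
      by (elim exE conjE)
    \<comment> \<open>The product at \<open>x\<close> before the edges at \<open>v\<close> are
      labelled; at \<open>v\<close> itself it is the empty product 1.\<close>
    define p where "p x = (\<Prod>w | E' x w. l' {x, w})" for x
    have finN: "finite N" using fin by (simp add: N_def)
    have E'N: "{w. E u w} = insert v {w. E' u w}" "v \<notin> {w. E' u w}" if "u \<in> N" for u
      using that sym irrefl unfolding N_def E'_def by blast+
    have E'nN: "{w. E u w} = {w. E' u w}" if "u \<notin> N" "u \<noteq> v" for u
      using that sym unfolding N_def E'_def by blast
    have finE': "finite {w. E' u w}" for u
      by (rule finite_subset[OF _ fin[of u]]) (auto simp: E'_def)
    have "l' {x, y} \<noteq> 0" if "E' x y" for x y
      using that l'L L0 unfolding E'_def by metis
    then have p0: "p x \<noteq> 0" for x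
      using finE' by (simp add: p_def)
    \<comment> \<open>Removed are the labels \<open>y\<close> with \<open>y * p u = p w\<close>,
      which would spoil an edge \<open>uw\<close> away from \<open>v\<close>. All such edges are
      covered, including those isolated in \<open>E'\<close>, about which the induction hypothesis
      says nothing.\<close>
    define S where "S u = L {v, u} - (\<lambda>w. p w / p u) ` {w. E' u w}" for u
    have "3 \<le> card (S u)" if u: "u \<in> N" for u
    proof -
      \<comment> \<open>As \<open>v\<close> is one of the at most \<open>D\<close> neighbours of
        \<open>u\<close>, at most \<open>D - 1\<close> labels are removed, leaving
        \<open>(D + 2) - (D - 1) = 3\<close>.\<close>
      have "Suc (card {w. E' u w}) \<le> D"
        using deg[of u] E'N[OF u] finE' by simp
      moreover have "card ((\<lambda>w. p w / p u) ` {w. E' u w}) \<le> card {w. E' u w}"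
        using finE' by (rule card_image_le)
      moreover have "D + 2 \<le> card (L {v, u})" using u cardL by (simp add: N_def)
      moreover have "card (L {v, u}) - card ((\<lambda>w. p w / p u) ` {w. E' u w}) \<le> card (S u)"
        unfolding S_def using finE' by (intro diff_card_le_card_Diff) simp
      ultimately show ?thesis by linarith
    qed
    moreover have "0 \<notin> S u" if "u \<in> N" for u
      using that L0 by (auto simp: S_def N_def)
    \<comment> \<open>The edge \<open>vu\<close> requires
      \<open>prod x N \<noteq> x u * p u\<close>; cancelling the nonzero \<open>x u\<close> gives
      the condition with constant \<open>p u\<close>.\<close>
    ultimately obtain x where xS: "\<And>u. u \<in> N \<Longrightarrow> x u \<in> S u"
      and xneq: "\<And>u. u \<in> N \<Longrightarrow> prod x (N - {u}) \<noteq> p u"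
      using exists_choice_prod_remove_neq[of N S p] finN v unfolding N_def by blast
    have xL: "x u \<in> L {v, u}" if "u \<in> N" for u
      using xS[OF that] by (simp add: S_def)
    then have x0: "x u \<noteq> 0" if "u \<in> N" for u
      using L0 that unfolding N_def by (metis mem_Collect_eq)
    \<comment> \<open>For an edge \<open>e\<close> at \<open>v\<close>,
      \<open>the_elem (e - {v})\<close> is its other end.\<close>
    define l where "l e = (if v \<in> e then x (the_elem (e - {v})) else l' e)" for e
    have l_v: "l {v, u} = x u" "l {u, v} = x u" if "u \<in> N" for u
    proof -
      have "{v, u} - {v} = {u}" "{u, v} - {v} = {u}" using that irrefl unfolding N_def by blast+
      then show "l {v, u} = x u" "l {u, v} = x u" by (simp_all add: l_def)
    qed
    have l_l': "l {y, z} = l' {y, z}" if "E' y z" for y z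
      using that by (auto simp: l_def E'_def)
    have prod_l': "(\<Prod>w | E' y w. l {y, w}) = p y" for y
      by (simp add: p_def l_l')
    have prod_v: "(\<Prod>w | E v w. l {v, w}) = prod x N"
      unfolding N_def[symmetric] by (intro prod.cong refl l_v)
    have prod_N: "(\<Prod>w | E u w. l {u, w}) = x u * p u" if "u \<in> N" for u
      using E'N[OF that] finE' that by (simp add: l_v prod_l')
    have prod_nN: "(\<Prod>w | E u w. l {u, w}) = p u" if "u \<notin> N" "u \<noteq> v" for u
      using E'nN[OF that] prod_l' by simp
    have vN: "(\<Prod>w | E v w. l {v, w}) \<noteq> (\<Prod>w | E u w. l {u, w})" if "u \<in> N" for u
      unfolding prod_v prod_N[OF that]
      using xneq[OF that] x0[OF that] prod.remove[OF finN that, of x] by simp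
    have NnN: "(\<Prod>w | E u w. l {u, w}) \<noteq> (\<Prod>w | E z w. l {z, w})" if "u \<in> N" "E' u z" for u z
    proof -
      \<comment> \<open>If \<open>z\<close> were adjacent to \<open>v\<close>, then
        \<open>v\<close>, \<open>u\<close>, \<open>z\<close> would form a triangle; hence the
        product at \<open>z\<close> remains \<open>p z\<close>.\<close>
      have "z \<notin> N" "z \<noteq> v" using that tri sym unfolding N_def E'_def by blast+
      moreover have "x u \<noteq> p z / p u" using xS[OF that(1)] that(2) by (auto simp: S_def)
      ultimately show ?thesis
        using prod_N[OF that(1)] prod_nN p0[of u] by (simp add: field_simps)
    qed
    have "l {y, z} \<in> L {y, z}" if yz: "E y z" for y z
    proof -
      consider "y = v" "z \<in> N" | "z = v" "y \<in> N" | "E' y z"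
        using yz sym unfolding N_def E'_def by blast
      then show ?thesis
      proof cases
        case 1 then show ?thesis using xL l_v(1) by simp
      next
        case 2 then show ?thesis using xL[of y] l_v(1)[of y] by (simp add: insert_commute)
      next
        case 3 then show ?thesis using l'L l_l' by simp
      qed
    qed
    moreover have "(\<Prod>w | E y w. l {y, w}) \<noteq> (\<Prod>w | E z w. l {z, w})"
      if yz: "E y z" and iso: "{w. E y w} \<noteq> {z} \<or> {w. E z w} \<noteq> {y}" for y z
    proof -
      consider "y = v" "z \<in> N" | "z = v" "y \<in> N" | "y \<in> N" "E' y z" | "z \<in> N" "E' z y"
        | "y \<notin> N" "y \<noteq> v" "z \<notin> N" "z \<noteq> v" "E' y z"
        using yz sym unfolding N_def E'_def by blast
      then show ?thesis
      proof cases
        case 1 then show ?thesis using vN by simp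
      next
        case 2 then show ?thesis using vN[of y] by simp
      next
        case 3 then show ?thesis using NnN by simp
      next
        case 4 then show ?thesis using NnN[of z y] by metis
      next
        case 5
        \<comment> \<open>Both ends keep their neighbourhoods, so the edge is not isolated in
          \<open>E'\<close> either and the induction hypothesis applies.\<close>
        then show ?thesis using l'neq[rule_format, of y z] iso E'nN[of y] E'nN[of z] prod_nN[of y] prod_nN[of z]
          by (simp add: p_def)
      qed
    qed
    ultimately show ?thesis by blast
  qed
qed

section \<open>Isolated edges and niceness\<close>

text \<open>No walk from \<open>u\<close> leaves \<open>{u, v}\<close>, so this set induces a
  strongly connected component, which symmetry of the arcs makes complete.\<close>

lemma (in graph) nice_imp_not_isolated_edge:
  assumes "nice G" and uv: "u \<rightarrow>\<^bsub>G\<^esub> v"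
    and Nu: "neighbours G u = {v}" and Nv: "neighbours G v = {u}"
  shows False
proof -
  let ?C = "G \<restriction> {u, v}"
  have inV: "u \<in> verts G" "v \<in> verts G" using uv by auto
  have "u \<noteq> v" using uv adj_not_same by blast
  have "w \<in> {u, v}" if "u \<rightarrow>\<^sup>*\<^bsub>G\<^esub> w" for w
    using that
  proof (induction rule: reachable_induct)
    case (step x y)
    then show ?case using Nu Nv by (auto simp: neighbours_def)
  qed simp
  moreover have "u \<rightarrow>\<^sup>*\<^bsub>G\<^esub> v" "u \<rightarrow>\<^sup>*\<^bsub>G\<^esub> u" using uv inV by auto
  ultimately have "{w. u \<rightarrow>\<^sup>*\<^bsub>G\<^esub> w} = {u, v}" by blast
  then have scc: "?C \<in> sccs" using induce_reachable_is_in_sccs[OF inV(1)] by simp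
  then have ind: "induced_subgraph ?C G" by (rule in_sccs_imp_induced)
  interpret C: digraph ?C using ind by (rule digraphI_induced)
  interpret C: sym_digraph ?C using ind by (rule induced_graph_imp_graph)
  have "graph ?C" by unfold_locales
  moreover have "arcs_ends ?C = {(x, y). (x, y) \<in> {u, v} \<times> {u, v} \<and> x \<noteq> y}"
  proof -
    have "v \<rightarrow>\<^bsub>G\<^esub> u" using uv sym_arcs by (rule arcs_ends_symmetric[rotated])
    moreover have "arcs_ends ?C = arcs_ends G \<inter> {u, v} \<times> {u, v}"
      by (auto simp: arcs_ends_conv)
    ultimately show ?thesis using uv adj_not_same by auto
  qed
  ultimately have "complete_digraph 2 ?C"
    using \<open>u \<noteq> v\<close> by (simp add: complete_digraph_def)
  with scc \<open>nice G\<close> show False by (auto simp: nice_def)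
qed

theorem corollary3p3:
  fixes G :: "('a, 'b) pre_digraph"
  assumes "graph G"
    and "nice G"
    and "triangle_free G"
  shows "ch_prod_star G \<le> enat (max_degree G + 3)"
proof -
  interpret graph G by fact
  have "\<exists>l. labelling G L l \<and> p_proper G l"
    if L: "list_assignment G (max_degree G + 3) L" and L0: "\<forall>e \<in> edges G. 0 \<notin> L e" for L
  proof -
    have edge: "{u, v} \<in> edges G" if "u \<rightarrow>\<^bsub>G\<^esub> v" for u v
      using that by (auto simp: edges_def)
    have deg: "card {w. v \<rightarrow>\<^bsub>G\<^esub> w} \<le> max_degree G" for v
    proof (cases "v \<in> verts G")
      case True
      then show ?thesis
        unfolding max_degree_def neighbours_def by (intro Max_ge) auto
    next
      \<comment> \<open>The degree bound is required for every element of the type; outside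
        \<open>verts G\<close> there are no neighbours.\<close>
      case False
      then have "{w. v \<rightarrow>\<^bsub>G\<^esub> w} = {}" by auto
      then show ?thesis by simp
    qed
    have "\<exists>l. (\<forall>u v. u \<rightarrow>\<^bsub>G\<^esub> v \<longrightarrow> l {u, v} \<in> L {u, v}) \<and>
      (\<forall>u v. u \<rightarrow>\<^bsub>G\<^esub> v \<longrightarrow> {w. u \<rightarrow>\<^bsub>G\<^esub> w} \<noteq> {v} \<or> {w. v \<rightarrow>\<^bsub>G\<^esub> w} \<noteq> {u} \<longrightarrow>
        (\<Prod>w | u \<rightarrow>\<^bsub>G\<^esub> w. l {u, w}) \<noteq> (\<Prod>w | v \<rightarrow>\<^bsub>G\<^esub> w. l {v, w}))"
    proof (rule exists_labelling_neq_except_isolated)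
      show "finite (verts G)" by simp
      show "v \<rightarrow>\<^bsub>G\<^esub> u" if "u \<rightarrow>\<^bsub>G\<^esub> v" for u v
        using that sym_arcs by (rule arcs_ends_symmetric[rotated])
      show "max_degree G + 2 \<le> card (L {u, v})" if "u \<rightarrow>\<^bsub>G\<^esub> v" for u v
        using L edge[OF that] by (simp add: list_assignment_def)
      show "\<not> w \<rightarrow>\<^bsub>G\<^esub> u" if "u \<rightarrow>\<^bsub>G\<^esub> v" "v \<rightarrow>\<^bsub>G\<^esub> w" for u v w
        using assms(3) that unfolding triangle_free_def by blast
      show "\<not> u \<rightarrow>\<^bsub>G\<^esub> u" for u
        using adj_not_same by blast
      show "0 \<notin> L {u, v}" if "u \<rightarrow>\<^bsub>G\<^esub> v" for u v
        using L0 edge[OF that] by blast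
    qed (use deg in auto)
    then obtain l where l: "\<forall>u v. u \<rightarrow>\<^bsub>G\<^esub> v \<longrightarrow> l {u, v} \<in> L {u, v}"
      and neq: "\<forall>u v. u \<rightarrow>\<^bsub>G\<^esub> v \<longrightarrow> {w. u \<rightarrow>\<^bsub>G\<^esub> w} \<noteq> {v} \<or> {w. v \<rightarrow>\<^bsub>G\<^esub> w} \<noteq> {u} \<longrightarrow>
        (\<Prod>w | u \<rightarrow>\<^bsub>G\<^esub> w. l {u, w}) \<noteq> (\<Prod>w | v \<rightarrow>\<^bsub>G\<^esub> w. l {v, w})"
      by (elim exE conjE)
    have "labelling G L l"
      using l by (auto simp: labelling_def edges_def)
    moreover have "p_proper G l"
      \<comment> \<open>In a nice graph no edge falls under the exemption.\<close>
      using neq nice_imp_not_isolated_edge[OF \<open>nice G\<close>]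
      unfolding p_proper_def vertex_product_def neighbours_def by blast
    ultimately show ?thesis by blast
  qed
  then show ?thesis
    unfolding ch_prod_star_def by (intro Inf_lower) auto
qed

end
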